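(* Consider $j\ge 1$ steps of the inexact explicit external deflation (EED) procedure for a real symmetric matrix $A\in\mathbb{R}^{n\times n}$: real shifts $\sigma_1,\ldots,\sigma_j$, real numbers $\widehat{\lambda}_1,\ldots,\widehat{\lambda}_{j+1}$, unit vectors $\widehat{v}_1,\ldots,\widehat{v}_{j+1}\in\mathbb{R}^n$ and residual vectors $\eta_1,\ldots,\eta_{j+1}\in\mathbb{R}^n$ with $$\Big(A+\sum_{k=1}^{i}\sigma_k\widehat{v}_k\widehat{v}_k^{\mathrm T}\Big)\widehat{v}_{i+1}=\widehat{\lambda}_{i+1}\widehat{v}_{i+1}+\eta_{i+1},\qquad i=0,1,\ldots,j,$$ and with spectral gap $\gamma_j>0$. If $\tau_j\,\omega_j<\sqrt{2}$, then the loss of orthogonality $\omega_{j+1}$ of the computed eigenvectors $\widehat{V}_{j+1}$ satisfies $$\omega_{j+1}\le 2\,\frac{c_j}{\gamma_j}\left(1+2\,\frac{c_j}{\gamma_j}\|E_{j+1}\|_{\mathrm F}\right)\|E_{j+1}\|_{\mathrm F},$$ where $c_j=(1-\tau_j\omega_j/\sqrt{2})^{-1}$.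
   Context: Notation: $\widehat{V}_i=[\widehat{v}_1,\ldots,\widehat{v}_i]$ and $E_i=[\eta_1,\ldots,\eta_i]$ are $n\times i$ matrices for $1\le i\le j+1$. $\|\cdot\|_{\mathrm F}$ is the Frobenius norm; unit vector means Euclidean norm $1$. Loss of orthogonality: $\omega_i=\|\widehat{V}_i^{\mathrm T}\widehat{V}_i-I_i\|_{\mathrm F}$. Spectral gap: $\gamma_j=\min\{|\lambda-\theta| : \lambda\in\{\widehat{\lambda}_1,\ldots,\widehat{\lambda}_{j+1}\},\ \theta\in\{\widehat{\lambda}_1+\sigma_1,\ldots,\widehat{\lambda}_j+\sigma_j\}\}$, assumed positive. Shift-gap ratio: $\tau_j=\frac{1}{\gamma_j}\max_{1\le i\le j}|\sigma_i|$. *)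

theory Defs
  imports "Jordan_Normal_Form.Matrix" "HOL-Analysis.L2_Norm"
begin

definition euclidean_norm :: "real vec \<Rightarrow> real" where
  "euclidean_norm v = L2_set (\<lambda>r. v $ r) {..<dim_vec v}"

definition frobenius_norm :: "real mat \<Rightarrow> real" where
  "frobenius_norm M = sqrt (\<Sum>r<dim_row M. \<Sum>c<dim_col M. (M $$ (r, c))\<^sup>2)"

definition outer_prod :: "real vec \<Rightarrow> real mat" where
  "outer_prod v = mat (dim_vec v) (dim_vec v) (\<lambda>(r, c). v $ r * v $ c)"

text \<open>
  All sequences are indexed from 1, as functions on \<^typ>\<open>nat\<close>; their values at 0 are
  irrelevant. \<open>col_mat n v i\<close> is the \<open>n \<times> i\<close> matrix \<open>[v 1, \<dots>, v i]\<close>.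
\<close>

definition col_mat :: "nat \<Rightarrow> (nat \<Rightarrow> real vec) \<Rightarrow> nat \<Rightarrow> real mat" where
  "col_mat n v i = mat_of_cols n (map v [1..<Suc i])"

text \<open>\<open>deflated A \<sigma> v i\<close> is \<open>A + (\<Sum>k = 1..i. \<sigma> k v k (v k)\<^sup>T)\<close>.\<close>

primrec deflated ::
  "real mat \<Rightarrow> (nat \<Rightarrow> real) \<Rightarrow> (nat \<Rightarrow> real vec) \<Rightarrow> nat \<Rightarrow> real mat" where
  "deflated A \<sigma> v 0 = A"
| "deflated A \<sigma> v (Suc i) = deflated A \<sigma> v i + \<sigma> (Suc i) \<cdot>\<^sub>m outer_prod (v (Suc i))"

text \<open>
  \<open>j\<close> steps of inexact explicit external deflation: \<open>v\<close>, \<open>lam\<close> are the computed unit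
  eigenvectors and eigenvalues, \<open>\<eta>\<close> the residuals.
\<close>

definition inexact_eed ::
  "nat \<Rightarrow> real mat \<Rightarrow> nat \<Rightarrow> (nat \<Rightarrow> real) \<Rightarrow> (nat \<Rightarrow> real) \<Rightarrow>
   (nat \<Rightarrow> real vec) \<Rightarrow> (nat \<Rightarrow> real vec) \<Rightarrow> bool" where
  "inexact_eed n A j \<sigma> lam v \<eta> \<longleftrightarrow>
     A \<in> carrier_mat n n \<and> transpose_mat A = A \<and>
     (\<forall>i\<in>{1..j+1}. v i \<in> carrier_vec n \<and> euclidean_norm (v i) = 1 \<and> \<eta> i \<in> carrier_vec n) \<and>
     (\<forall>i\<in>{0..j}. deflated A \<sigma> v i *\<^sub>v v (i+1) = lam (i+1) \<cdot>\<^sub>v v (i+1) + \<eta> (i+1))"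

definition orth_loss :: "nat \<Rightarrow> (nat \<Rightarrow> real vec) \<Rightarrow> nat \<Rightarrow> real" where
  "orth_loss n v i =
     frobenius_norm (transpose_mat (col_mat n v i) * col_mat n v i - 1\<^sub>m i)"

definition spectral_gap :: "(nat \<Rightarrow> real) \<Rightarrow> (nat \<Rightarrow> real) \<Rightarrow> nat \<Rightarrow> real" where
  "spectral_gap lam \<sigma> j =
     Min {\<bar>l - \<theta>\<bar> | l \<theta>. l \<in> lam ` {1..j+1} \<and> \<theta> \<in> (\<lambda>i. lam i + \<sigma> i) ` {1..j}}"

definition shift_gap_ratio :: "(nat \<Rightarrow> real) \<Rightarrow> (nat \<Rightarrow> real) \<Rightarrow> nat \<Rightarrow> real" where
  "shift_gap_ratio lam \<sigma> j =
     1 / spectral_gap lam \<sigma> j * Max ((\<lambda>i. \<bar>\<sigma> i\<bar>) ` {1..j})"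

end

theory Submission
  imports Defs
begin

text \<open>
  Write \<open>g l m\<close> for the inner product of \<open>v l\<close> and \<open>v m\<close>, and let \<open>U\<close> be the strictly upper
  triangular part of the Gram matrix, so that the loss of orthogonality \<open>\<omega>\<close> is \<open>sqrt 2\<close> times the
  Frobenius norm of \<open>U\<close>. Evaluating the bilinear form of the symmetric matrix \<open>A\<close> at \<open>v l\<close>, \<open>v m\<close>
  for \<open>l < m\<close> in two ways gives
  \<open>(lam m - lam l - \<sigma> l) g l m = v m \<cdot> \<eta> l - v l \<cdot> \<eta> m + (\<Sum>l<k<m. \<sigma> k g l k g k m)\<close>.
  The last sum is an entry of a product of two strictly upper triangular matrices, the first of
  which only involves the first \<open>j\<close> vectors. Taking Frobenius norms, this term can be absorbed
  in the left-hand side, leaving \<open>\<omega> \<le> 2 (c / \<gamma>) sqrt (1 + \<omega>) e\<close>, because the squared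
  spectral norm of \<open>V\<close> is at most \<open>1 + \<omega>\<close>. The claim follows by solving for \<open>\<omega>\<close>.
\<close>

section \<open>Frobenius norms as \<open>\<ell>\<^sup>2\<close> norms over pairs of indices\<close>

lemma sum_mult_le_L2_set: "(\<Sum>i\<in>A. f i * g i) \<le> L2_set f A * L2_set g A"
proof -
  have "(\<Sum>i\<in>A. f i * g i) \<le> (\<Sum>i\<in>A. \<bar>f i\<bar> * \<bar>g i\<bar>)"
    by (intro sum_mono) (metis abs_ge_self abs_mult)
  also have "\<dots> \<le> L2_set f A * L2_set g A"
    by (rule L2_set_mult_ineq)
  finally show ?thesis .
qed

lemma L2_set_squared: "(L2_set f A)\<^sup>2 = (\<Sum>i\<in>A. (f i)\<^sup>2)"
  by (simp add: L2_set_def sum_nonneg)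

lemma L2_set_abs: "L2_set (\<lambda>i. \<bar>f i\<bar>) A = L2_set f A"
  by (simp add: L2_set_def)

lemma L2_set_mono_set:
  assumes "finite B" "A \<subseteq> B"
  shows "L2_set f A \<le> L2_set f B"
  unfolding L2_set_def using assms by (intro real_sqrt_le_mono sum_mono2) auto

text \<open>Submultiplicativity of the Frobenius norm: Cauchy-Schwarz bounds each squared entry by a
  row factor times a column factor, and the double sum of these products factorises. The three index
  sets are independent, so the inner index can later be confined to the first \<open>j\<close>
  vectors.\<close>

lemma L2_set_matrix_mult_le:
  "L2_set (\<lambda>(l, m). \<Sum>k\<in>K. P l k * Q k m) (I \<times> J)
    \<le> L2_set (\<lambda>(l, k). P l k) (I \<times> K) * L2_set (\<lambda>(k, m). Q k m) (K \<times> J)"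
proof (rule power2_le_imp_le)
  have entry: "(\<Sum>k\<in>K. P l k * Q k m)\<^sup>2 \<le> (\<Sum>k\<in>K. (P l k)\<^sup>2) * (\<Sum>k\<in>K. (Q k m)\<^sup>2)" for l m
  proof -
    have "\<bar>\<Sum>k\<in>K. P l k * Q k m\<bar> \<le> (\<Sum>k\<in>K. \<bar>P l k\<bar> * \<bar>Q k m\<bar>)"
      by (metis (no_types, lifting) abs_mult sum.cong sum_abs)
    also have "\<dots> \<le> L2_set (P l) K * L2_set (\<lambda>k. Q k m) K"
      by (rule L2_set_mult_ineq)
    finally have "\<bar>\<Sum>k\<in>K. P l k * Q k m\<bar>\<^sup>2 \<le> (L2_set (P l) K * L2_set (\<lambda>k. Q k m) K)\<^sup>2"
      by (intro power_mono) auto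
    then show ?thesis
      by (simp add: power_mult_distrib L2_set_squared)
  qed
  have "(L2_set (\<lambda>(l, m). \<Sum>k\<in>K. P l k * Q k m) (I \<times> J))\<^sup>2
      = (\<Sum>l\<in>I. \<Sum>m\<in>J. (\<Sum>k\<in>K. P l k * Q k m)\<^sup>2)"
    by (simp add: L2_set_squared sum.cartesian_product case_prod_unfold)
  also have "\<dots> \<le> (\<Sum>l\<in>I. \<Sum>m\<in>J. (\<Sum>k\<in>K. (P l k)\<^sup>2) * (\<Sum>k\<in>K. (Q k m)\<^sup>2))"
    by (intro sum_mono entry)
  also have "\<dots> = (\<Sum>l\<in>I. \<Sum>k\<in>K. (P l k)\<^sup>2) * (\<Sum>m\<in>J. \<Sum>k\<in>K. (Q k m)\<^sup>2)"
    by (simp add: sum_product)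
  also have "(\<Sum>m\<in>J. \<Sum>k\<in>K. (Q k m)\<^sup>2) = (\<Sum>k\<in>K. \<Sum>m\<in>J. (Q k m)\<^sup>2)"
    by (rule sum.swap)
  also have "(\<Sum>l\<in>I. \<Sum>k\<in>K. (P l k)\<^sup>2) * (\<Sum>k\<in>K. \<Sum>m\<in>J. (Q k m)\<^sup>2)
      = (L2_set (\<lambda>(l, k). P l k) (I \<times> K) * L2_set (\<lambda>(k, m). Q k m) (K \<times> J))\<^sup>2"
    by (simp add: power_mult_distrib L2_set_squared sum.cartesian_product case_prod_unfold)
  finally show "(L2_set (\<lambda>(l, m). \<Sum>k\<in>K. P l k * Q k m) (I \<times> J))\<^sup>2
      \<le> (L2_set (\<lambda>(l, k). P l k) (I \<times> K) * L2_set (\<lambda>(k, m). Q k m) (K \<times> J))\<^sup>2" .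
qed simp

lemma L2_set_transpose:
  "L2_set (\<lambda>(l, m). f m l) (I \<times> J) = L2_set (\<lambda>(l, m). f l m) (J \<times> I)"
proof -
  have "(\<Sum>l\<in>I. \<Sum>m\<in>J. (f m l)\<^sup>2) = (\<Sum>l\<in>J. \<Sum>m\<in>I. (f l m)\<^sup>2)"
    by (rule sum.swap)
  then show ?thesis
    by (simp add: L2_set_def sum.cartesian_product case_prod_unfold)
qed

text \<open>Each off-diagonal pair occurs twice in the full sum of squares. Symmetry is required of
  absolute values only, so that both the symmetric \<open>V^T V - I\<close> and an antisymmetric
  residual matrix are covered.\<close>

lemma L2_set_upper_triangular:
  fixes f :: "'a::linorder \<Rightarrow> 'a \<Rightarrow> real"
  assumes sym: "\<And>l m. l \<in> I \<Longrightarrow> m \<in> I \<Longrightarrow> \<bar>f l m\<bar> = \<bar>f m l\<bar>"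
    and diag: "\<And>l. l \<in> I \<Longrightarrow> f l l = 0"
  shows "L2_set (\<lambda>(l, m). f l m) (I \<times> I)
    = sqrt 2 * L2_set (\<lambda>(l, m). if l < m then f l m else 0) (I \<times> I)"
proof -
  let ?u = "\<lambda>l m. if l < m then (f l m)\<^sup>2 else 0"
  have sq: "(f l m)\<^sup>2 = ?u l m + ?u m l" if "l \<in> I" "m \<in> I" for l m
    using sym[OF that] diag that by (cases l m rule: linorder_cases) (auto simp: power2_eq_iff abs_eq_iff)
  have "(\<Sum>l\<in>I. \<Sum>m\<in>I. (f l m)\<^sup>2) = (\<Sum>l\<in>I. \<Sum>m\<in>I. ?u l m + ?u m l)"
    by (intro sum.cong refl sq)
  also have "\<dots> = (\<Sum>l\<in>I. \<Sum>m\<in>I. ?u l m) + (\<Sum>l\<in>I. \<Sum>m\<in>I. ?u m l)"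
    by (simp add: sum.distrib)
  also have "(\<Sum>l\<in>I. \<Sum>m\<in>I. ?u m l) = (\<Sum>l\<in>I. \<Sum>m\<in>I. ?u l m)"
    by (rule sum.swap)
  finally have "(\<Sum>l\<in>I. \<Sum>m\<in>I. (f l m)\<^sup>2) = 2 * (\<Sum>l\<in>I. \<Sum>m\<in>I. ?u l m)"
    by simp
  moreover have "(\<Sum>l\<in>I. \<Sum>m\<in>I. ?u l m) = (\<Sum>l\<in>I. \<Sum>m\<in>I. (if l < m then f l m else 0)\<^sup>2)"
    by (intro sum.cong) auto
  ultimately show ?thesis
    by (simp add: L2_set_def sum.cartesian_product case_prod_unfold real_sqrt_mult)
qed

section \<open>Inner products\<close>

lemma scalar_prod_self: "v \<bullet> v = (euclidean_norm v)\<^sup>2" for v :: "real vec"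
  unfolding euclidean_norm_def L2_set_squared
  by (simp add: scalar_prod_def power2_eq_square atLeast0LessThan)

lemma outer_prod_mult_vec:
  assumes "w \<in> carrier_vec n" "x \<in> carrier_vec n" "y \<in> carrier_vec n"
  shows "x \<bullet> (outer_prod w *\<^sub>v y) = (x \<bullet> w) * (w \<bullet> y)"
proof -
  have "outer_prod w *\<^sub>v y = (w \<bullet> y) \<cdot>\<^sub>v w"
    using assms by (intro eq_vecI)
      (auto simp: outer_prod_def scalar_prod_def sum_distrib_left mult_ac intro!: sum.cong)
  then show ?thesis
    using assms by (simp add: scalar_prod_smult_distrib)
qed

section \<open>Bilinear forms of the deflated and of symmetric matrices\<close>

lemma deflated_carrier:
  assumes "A \<in> carrier_mat n n" "\<And>k. k \<in> {1..i} \<Longrightarrow> v k \<in> carrier_vec n"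
  shows "deflated A \<sigma> v i \<in> carrier_mat n n"
  using assms by (induction i) (auto simp: outer_prod_def)

lemma scalar_prod_deflated:
  assumes "A \<in> carrier_mat n n" "\<And>k. k \<in> {1..i} \<Longrightarrow> v k \<in> carrier_vec n"
    and "x \<in> carrier_vec n" "y \<in> carrier_vec n"
  shows "x \<bullet> (deflated A \<sigma> v i *\<^sub>v y)
    = x \<bullet> (A *\<^sub>v y) + (\<Sum>k = 1..i. \<sigma> k * ((x \<bullet> v k) * (v k \<bullet> y)))"
  using assms(2)
proof (induction i)
  case 0
  then show ?case by simp
next
  case (Suc i)
  have D: "deflated A \<sigma> v i \<in> carrier_mat n n"
    using Suc.prems by (intro deflated_carrier assms(1)) auto
  have w: "v (Suc i) \<in> carrier_vec n"
    using Suc.prems by auto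
  then have O: "outer_prod (v (Suc i)) \<in> carrier_mat n n"
    by (auto simp: outer_prod_def)
  have "deflated A \<sigma> v (Suc i) *\<^sub>v y
      = deflated A \<sigma> v i *\<^sub>v y + \<sigma> (Suc i) \<cdot>\<^sub>v (outer_prod (v (Suc i)) *\<^sub>v y)"
    using D O assms(4)
    by (intro eq_vecI) (auto simp: add_scalar_prod_distrib[where n = n])
  then have "x \<bullet> (deflated A \<sigma> v (Suc i) *\<^sub>v y)
      = x \<bullet> (deflated A \<sigma> v i *\<^sub>v y) + \<sigma> (Suc i) * (x \<bullet> (outer_prod (v (Suc i)) *\<^sub>v y))"
    using D O assms(3,4) by (simp add: scalar_prod_add_distrib[where n = n])
  then show ?case
    using Suc outer_prod_mult_vec[OF w assms(3,4)] by simp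
qed

lemma symmetric_mat_scalar_prod:
  fixes A :: "'a::comm_ring mat"
  assumes "A \<in> carrier_mat n n" "transpose_mat A = A" "x \<in> carrier_vec n" "y \<in> carrier_vec n"
  shows "x \<bullet> (A *\<^sub>v y) = y \<bullet> (A *\<^sub>v x)"
proof -
  have "x \<bullet> (A *\<^sub>v y) = (A *\<^sub>v x) \<bullet> y"
    using transpose_vec_mult_scalar[OF assms(1,4,3)] assms by simp
  also have "\<dots> = y \<bullet> (A *\<^sub>v x)"
    using assms by (intro comm_scalar_prod[where n = n]) auto
  finally show ?thesis .
qed

section \<open>Gram matrices: loss of orthogonality and the spectral norm of
  \<open>V\<close>\<close>

lemma orth_loss_eq:
  assumes "\<And>l. l \<in> {1..i} \<Longrightarrow> v l \<in> carrier_vec n"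
  shows "orth_loss n v i
    = L2_set (\<lambda>(l, m). v l \<bullet> v m - (if l = m then 1 else 0)) ({1..i} \<times> {1..i})"
proof -
  let ?M = "transpose_mat (col_mat n v i) * col_mat n v i - 1\<^sub>m i"
  have dim: "dim_row ?M = i" "dim_col ?M = i"
    by (auto simp: col_mat_def)
  \<comment> \<open>Matrix entries count from 0 and the sequences from 1, hence the
    \<open>Suc\<close>.\<close>
  have entry: "?M $$ (r, c) = v (Suc r) \<bullet> v (Suc c) - (if Suc r = Suc c then 1 else 0)"
    if "r < i" "c < i" for r c
    using that assms by (simp add: col_mat_def del: upt_Suc)
  have "orth_loss n v i
      = sqrt (\<Sum>r<i. \<Sum>c<i. (v (Suc r) \<bullet> v (Suc c) - (if Suc r = Suc c then 1 else 0))\<^sup>2)"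
    unfolding orth_loss_def frobenius_norm_def dim
    by (intro arg_cong[where f = sqrt] sum.cong refl) (simp only: entry lessThan_iff)
  also have "\<dots> = sqrt (\<Sum>l\<in>{1..i}. \<Sum>m\<in>{1..i}. (v l \<bullet> v m - (if l = m then 1 else 0))\<^sup>2)"
    by (simp add: sum.atLeast1_atMost_eq)
  finally show ?thesis
    by (simp add: L2_set_def sum.cartesian_product case_prod_unfold)
qed

lemma frobenius_col_mat_squared:
  assumes "\<And>l. l \<in> {1..i} \<Longrightarrow> v l \<in> carrier_vec n"
  shows "(frobenius_norm (col_mat n v i))\<^sup>2 = (\<Sum>l = 1..i. v l \<bullet> v l)"
proof -
  have dim: "dim_row (col_mat n v i) = n" "dim_col (col_mat n v i) = i"
    by (auto simp: col_mat_def)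
  have entry: "col_mat n v i $$ (r, c) = v (Suc c) $ r" if "r < n" "c < i" for r c
    using that by (simp add: col_mat_def mat_of_cols_index del: upt_Suc)
  have self: "v (Suc c) \<bullet> v (Suc c) = (\<Sum>r<n. (v (Suc c) $ r)\<^sup>2)" if "c < i" for c
    using assms[of "Suc c"] that by (simp add: scalar_prod_def power2_eq_square atLeast0LessThan)
  have "(frobenius_norm (col_mat n v i))\<^sup>2 = (\<Sum>r<n. \<Sum>c<i. (v (Suc c) $ r)\<^sup>2)"
    unfolding frobenius_norm_def dim by (simp add: entry sum_nonneg)
  also have "\<dots> = (\<Sum>c<i. \<Sum>r<n. (v (Suc c) $ r)\<^sup>2)"
    by (rule sum.swap)
  also have "\<dots> = (\<Sum>c<i. v (Suc c) \<bullet> v (Suc c))"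
    by (simp add: self)
  finally show ?thesis
    by (simp add: sum.atLeast1_atMost_eq)
qed

text \<open>Cauchy-Schwarz for \<open>y\<close> and \<open>z = V V\<^sup>T y\<close>.\<close>

lemma sum_scalar_prod_squares_le:
  assumes v: "\<And>l. l \<in> {1..i} \<Longrightarrow> v l \<in> carrier_vec n" and y: "y \<in> carrier_vec n"
  shows "(\<Sum>m = 1..i. (y \<bullet> v m)\<^sup>2) \<le> (1 + orth_loss n v i) * (y \<bullet> y)"
proof -
  define I where "I = {1..i}"
  define a where "a m = y \<bullet> v m" for m
  define s where "s = (\<Sum>m\<in>I. (a m)\<^sup>2)"
  define z where "z r = (\<Sum>m\<in>I. a m * v m $ r)" for r
  define \<omega> where "\<omega> = orth_loss n v i"
  have s0: "s \<ge> 0" "\<omega> \<ge> 0"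
    by (auto simp: s_def sum_nonneg \<omega>_def orth_loss_def frobenius_norm_def)
  have gram: "v l \<bullet> v m = (\<Sum>r<n. v l $ r * v m $ r)" if "m \<in> I" for l m
    using v[of m] that by (simp add: scalar_prod_def I_def atLeast0LessThan)
  have a: "a m = (\<Sum>r<n. y $ r * v m $ r)" if "m \<in> I" for m
    using v[of m] that by (simp add: a_def scalar_prod_def I_def atLeast0LessThan)
  \<comment> \<open>With \<open>a = V^T y\<close> and \<open>z = V a\<close>, this computes
    \<open>s\<close>, the squared norm of \<open>a\<close>, as the inner product of \<open>y\<close>
    and \<open>z\<close>.\<close>
  have "s = (\<Sum>m\<in>I. \<Sum>r<n. a m * (y $ r * v m $ r))"
    unfolding s_def by (intro sum.cong refl) (simp add: power2_eq_square sum_distrib_left[symmetric] a)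
  also have "\<dots> = (\<Sum>r<n. \<Sum>m\<in>I. a m * (y $ r * v m $ r))"
    by (rule sum.swap)
  also have "\<dots> = (\<Sum>r<n. y $ r * z r)"
    by (simp add: z_def sum_distrib_left mult_ac)
  also have "\<dots> \<le> L2_set (($) y) {..<n} * L2_set z {..<n}"
    by (rule sum_mult_le_L2_set)
  finally have "s\<^sup>2 \<le> (L2_set (($) y) {..<n} * L2_set z {..<n})\<^sup>2"
    using s0 by (intro power_mono) auto
  then have s2: "s\<^sup>2 \<le> (y \<bullet> y) * (\<Sum>r<n. (z r)\<^sup>2)"
    using y by (simp add: power_mult_distrib L2_set_squared scalar_prod_self euclidean_norm_def)
  have "(\<Sum>r<n. (z r)\<^sup>2) = (\<Sum>r<n. \<Sum>l\<in>I. \<Sum>m\<in>I. a l * a m * (v l $ r * v m $ r))"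
    by (simp add: z_def power2_eq_square sum_product mult_ac)
  also have "\<dots> = (\<Sum>l\<in>I. \<Sum>r<n. \<Sum>m\<in>I. a l * a m * (v l $ r * v m $ r))"
    by (rule sum.swap)
  also have "\<dots> = (\<Sum>l\<in>I. \<Sum>m\<in>I. \<Sum>r<n. a l * a m * (v l $ r * v m $ r))"
    by (intro sum.cong refl sum.swap)
  also have "\<dots> = (\<Sum>l\<in>I. \<Sum>m\<in>I. a l * a m * (v l \<bullet> v m))"
    by (simp add: gram sum_distrib_left)
  \<comment> \<open>Split \<open>V^T V\<close> into the identity and its deviation. The identity
    contributes \<open>s\<close>; by Cauchy-Schwarz over pairs the deviation contributes at most
    \<open>\<omega>\<close> times the Frobenius norm of \<open>a a^T\<close>, which is
    \<open>s\<close> again.\<close>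
  also have "\<dots> = (\<Sum>l\<in>I. \<Sum>m\<in>I. (if l = m then a l * a m else 0)
      + a l * a m * (v l \<bullet> v m - (if l = m then 1 else 0)))"
    by (intro sum.cong) (auto simp: algebra_simps)
  also have "\<dots> = s + (\<Sum>(l, m)\<in>I \<times> I. (a l * a m) * (v l \<bullet> v m - (if l = m then 1 else 0)))"
    by (simp add: sum.distrib s_def I_def power2_eq_square sum.cartesian_product)
  also have "(\<Sum>(l, m)\<in>I \<times> I. (a l * a m) * (v l \<bullet> v m - (if l = m then 1 else 0)))
      \<le> L2_set (\<lambda>(l, m). a l * a m) (I \<times> I) * \<omega>"
    using sum_mult_le_L2_set[of "\<lambda>(l, m). a l * a m"
        "\<lambda>(l, m). v l \<bullet> v m - (if l = m then 1 else 0)" "I \<times> I"]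
      orth_loss_eq[of i v n] v
    by (simp add: \<omega>_def I_def case_prod_unfold)
  also have "L2_set (\<lambda>(l, m). a l * a m) (I \<times> I) = s"
  proof -
    have "L2_set (\<lambda>(l, m). a l * a m) (I \<times> I) = sqrt (s\<^sup>2)"
      by (simp add: L2_set_def s_def power2_eq_square[of "sum _ _"] sum_product
          sum.cartesian_product case_prod_unfold power_mult_distrib)
    then show ?thesis using s0 by simp
  qed
  finally have "(\<Sum>r<n. (z r)\<^sup>2) \<le> s * (1 + \<omega>)"
    by (simp add: algebra_simps)
  then have "s\<^sup>2 \<le> (y \<bullet> y) * (s * (1 + \<omega>))"
    using s2 by (smt (verit) mult_left_mono scalar_prod_self zero_le_power2)
  then have "s * s \<le> s * ((1 + \<omega>) * (y \<bullet> y))"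
    by (simp add: power2_eq_square mult_ac)
  \<comment> \<open>Cancelling \<open>s\<close> requires \<open>s \<noteq> 0\<close>; for
    \<open>s = 0\<close> the nonnegativity of the bound suffices.\<close>
  moreover have "0 \<le> (1 + \<omega>) * (y \<bullet> y)"
    using s0 by (simp add: scalar_prod_self)
  ultimately have "s \<le> (1 + \<omega>) * (y \<bullet> y)"
    using s0 by (cases "s = 0") auto
  then show ?thesis
    by (simp add: s_def a_def I_def \<omega>_def)
qed

text \<open>Squaring gives \<open>x * (x - 4 * a^2) \<le> 4 * a^2\<close>. If the claim failed, both
  factors on the left would be large enough to make the product at least
  \<open>4 * a^2 + 8 * a^3\<close>, which forces \<open>a = 0\<close> and then contradicts
  \<open>x > 0\<close>.\<close>

lemma le_of_le_mult_sqrt: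
  fixes x a :: real
  assumes "x \<ge> 0" "a \<ge> 0" "x \<le> 2 * a * sqrt (1 + x)"
  shows "x \<le> 2 * a * (1 + 2 * a)"
proof (rule ccontr)
  assume "\<not> ?thesis"
  then have x: "x > 2 * a + 4 * a\<^sup>2"
    by (simp add: algebra_simps power2_eq_square)
  have "x\<^sup>2 \<le> (2 * a * sqrt (1 + x))\<^sup>2"
    using assms by (intro power_mono) auto
  then have "x * (x - 4 * a\<^sup>2) \<le> 4 * a\<^sup>2"
    using assms(1) by (simp add: power_mult_distrib algebra_simps power2_eq_square)
  moreover have "x * (x - 4 * a\<^sup>2) \<ge> x * (2 * a)"
    using x assms by (intro mult_left_mono) auto
  moreover have "x * (2 * a) \<ge> (2 * a + 4 * a\<^sup>2) * (2 * a)"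
    using x assms by (intro mult_right_mono) auto
  moreover have "(2 * a + 4 * a\<^sup>2) * (2 * a) = 4 * a\<^sup>2 + 8 * a ^ 3"
    by (simp add: algebra_simps power2_eq_square power3_eq_cube)
  ultimately have "a ^ 3 \<le> 0" by linarith
  then have "a = 0" using assms(2)
    by (metis antisym power_eq_0_iff zero_le_power)
  then show False using assms x by simp
qed

section \<open>The error recurrence for the Gram matrix\<close>

text \<open>Test the equation for \<open>v m\<close> against \<open>v l\<close> and conversely, then
  subtract. Symmetry cancels the terms with \<open>A\<close>, and the shifts with
  \<open>k < l\<close> occur in both equations. The shift \<open>k = l\<close> occurs only in the
  one for \<open>v m\<close>; as \<open>v l\<close> is a unit vector, it joins the eigenvalue
  difference on the left.\<close>

lemma gram_recurrence:
  assumes eed: "inexact_eed n A j \<sigma> lam v \<eta>"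
    and lm: "1 \<le> l" "l < m" "m \<le> j + 1"
  shows "(lam m - (lam l + \<sigma> l)) * (v l \<bullet> v m)
    = \<eta> l \<bullet> v m - \<eta> m \<bullet> v l + (\<Sum>k\<in>{l<..<m}. \<sigma> k * ((v l \<bullet> v k) * (v k \<bullet> v m)))"
proof -
  have A: "A \<in> carrier_mat n n" "transpose_mat A = A"
    and v: "\<And>i. i \<in> {1..j+1} \<Longrightarrow> v i \<in> carrier_vec n"
    and \<eta>: "\<And>i. i \<in> {1..j+1} \<Longrightarrow> \<eta> i \<in> carrier_vec n"
    and unit: "v l \<bullet> v l = 1"
    using eed lm by (auto simp: inexact_eed_def scalar_prod_self)
  \<comment> \<open>The vector \<open>v q\<close> is computed after \<open>q - 1\<close> deflations,
    so exactly the shifts with \<open>k < q\<close> appear.\<close>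
  have form: "v p \<bullet> (A *\<^sub>v v q) + (\<Sum>k = 1..<q. \<sigma> k * ((v p \<bullet> v k) * (v k \<bullet> v q)))
      = lam q * (v p \<bullet> v q) + v p \<bullet> \<eta> q"
    if pq: "p \<in> {1..j+1}" "q \<in> {1..j+1}" for p q
  proof -
    obtain i where i: "q = Suc i" "i \<in> {0..j}"
      using pq(2) by (cases q) auto
    have "v p \<bullet> (deflated A \<sigma> v i *\<^sub>v v q) = v p \<bullet> (lam q \<cdot>\<^sub>v v q + \<eta> q)"
      using eed i by (simp add: inexact_eed_def)
    also have "\<dots> = lam q * (v p \<bullet> v q) + v p \<bullet> \<eta> q"
      using v[OF pq(1)] v[OF pq(2)] \<eta>[OF pq(2)]
      by (simp add: scalar_prod_add_distrib[where n = n])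
    finally show ?thesis
      using i v pq by (subst (asm) scalar_prod_deflated[OF A(1)])
        (auto simp: atLeastLessThanSuc_atLeastAtMost)
  qed
  have l: "l \<in> {1..j+1}" and m: "m \<in> {1..j+1}" using lm by auto
  note comm = comm_scalar_prod[where n = n]
  let ?t = "\<lambda>k. \<sigma> k * ((v l \<bullet> v k) * (v k \<bullet> v m))"
  have "(\<Sum>k = 1..<l. \<sigma> k * ((v m \<bullet> v k) * (v k \<bullet> v l))) = (\<Sum>k = 1..<l. ?t k)"
    using lm by (intro sum.cong refl) (auto simp: comm v)
  moreover have "(\<Sum>k = 1..<m. ?t k) = (\<Sum>k = 1..<l. ?t k) + \<sigma> l * (v l \<bullet> v m) + (\<Sum>k\<in>{l<..<m}. ?t k)"
  proof -
    have "(\<Sum>k = 1..<m. ?t k) = (\<Sum>k = 1..<l. ?t k) + (\<Sum>k = l..<m. ?t k)"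
      using lm by (simp add: sum.atLeastLessThan_concat)
    also have "{l..<m} = insert l {l<..<m}"
      using lm by auto
    finally show ?thesis by (simp add: unit)
  qed
  moreover have "v l \<bullet> (A *\<^sub>v v m) = v m \<bullet> (A *\<^sub>v v l)"
    using symmetric_mat_scalar_prod[OF A] v l m by blast
  moreover have "v m \<bullet> v l = v l \<bullet> v m" "v m \<bullet> \<eta> l = \<eta> l \<bullet> v m" "v l \<bullet> \<eta> m = \<eta> m \<bullet> v l"
    by (auto intro!: comm v \<eta> l m simp del: atLeastAtMost_iff)
  ultimately show ?thesis
    using form[OF l m] form[OF m l] by (simp add: algebra_simps)
qed

lemma spectral_gap_le:
  assumes "1 \<le> l" "l \<le> j" "1 \<le> m" "m \<le> j + 1"
  shows "spectral_gap lam \<sigma> j \<le> \<bar>lam m - (lam l + \<sigma> l)\<bar>"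
proof -
  let ?L = "lam ` {1..j+1}" and ?T = "(\<lambda>i. lam i + \<sigma> i) ` {1..j}"
  \<comment> \<open>As the image of a product of finite sets the set is finite, which
    \<open>Min_le\<close> requires.\<close>
  have "{\<bar>l - \<theta>\<bar> | l \<theta>. l \<in> ?L \<and> \<theta> \<in> ?T} = (\<lambda>(l, \<theta>). \<bar>l - \<theta>\<bar>) ` (?L \<times> ?T)"
    by auto
  then have "finite {\<bar>l - \<theta>\<bar> | l \<theta>. l \<in> ?L \<and> \<theta> \<in> ?T}"
    by simp
  moreover have "lam m \<in> ?L" "lam l + \<sigma> l \<in> ?T"
    using assms by auto
  then have "\<bar>lam m - (lam l + \<sigma> l)\<bar> \<in> {\<bar>l - \<theta>\<bar> | l \<theta>. l \<in> ?L \<and> \<theta> \<in> ?T}"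
    by blast
  ultimately show ?thesis
    unfolding spectral_gap_def by (rule Min_le)
qed

section \<open>Absorbing the quadratic term and solving for the loss of orthogonality\<close>

theorem theorem3p1:
  fixes n j :: nat
    and A :: "real mat"
    and \<sigma> lam :: "nat \<Rightarrow> real"
    and v \<eta> :: "nat \<Rightarrow> real vec"
  assumes "j \<ge> 1"
    and "inexact_eed n A j \<sigma> lam v \<eta>"
    and "spectral_gap lam \<sigma> j > 0"
    and "shift_gap_ratio lam \<sigma> j * orth_loss n v j < sqrt 2"
  shows "let \<gamma> = spectral_gap lam \<sigma> j;
             c = inverse (1 - shift_gap_ratio lam \<sigma> j * orth_loss n v j / sqrt 2);
             e = frobenius_norm (col_mat n \<eta> (j + 1))
         in orth_loss n v (j + 1) \<le> 2 * (c / \<gamma>) * (1 + 2 * (c / \<gamma>) * e) * e"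
proof -
  define \<gamma> where "\<gamma> = spectral_gap lam \<sigma> j"
  define S where "S = Max ((\<lambda>i. \<bar>\<sigma> i\<bar>) ` {1..j})"
  define \<omega> where "\<omega> i = orth_loss n v i" for i
  \<comment> \<open>The reciprocal of \<open>c_j\<close>; it is positive by the hypothesis on
    \<open>\<tau>_j \<omega>_j\<close>.\<close>
  define d where "d = 1 - shift_gap_ratio lam \<sigma> j * \<omega> j / sqrt 2"
  define e where "e = frobenius_norm (col_mat n \<eta> (j + 1))"
  define I where "I = {1..j+1}"
  define U where "U l m = (if l < m then v l \<bullet> v m else 0)" for l m
  define X where "X l m = \<eta> l \<bullet> v m - \<eta> m \<bullet> v l" for l m
  define Y where "Y l m = (if l < m then X l m else 0)" for l m
  have v: "\<And>i. i \<in> I \<Longrightarrow> v i \<in> carrier_vec n"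
    and unit: "\<And>i. i \<in> I \<Longrightarrow> v i \<bullet> v i = 1"
    and \<eta>: "\<And>i. i \<in> I \<Longrightarrow> \<eta> i \<in> carrier_vec n"
    using assms(2) by (auto simp: inexact_eed_def I_def scalar_prod_self)
  have \<gamma>0: "\<gamma> > 0" and d0: "d > 0" and e0: "e \<ge> 0" and \<omega>0: "\<omega> i \<ge> 0" for i
    using assms(3,4)
    by (auto simp: \<gamma>_def d_def \<omega>_def e_def orth_loss_def frobenius_norm_def sum_nonneg)
  have S: "\<bar>\<sigma> k\<bar> \<le> S" if "k \<in> {1..j}" for k
    unfolding S_def using that by (intro Max_ge) auto
  have S0: "S \<ge> 0"
    using S[of 1] assms(1) by (auto intro: order_trans[OF abs_ge_zero])

  have loss: "\<omega> i = sqrt 2 * L2_set (\<lambda>(l, m). U l m) ({1..i} \<times> {1..i})" if "i \<le> j + 1" for i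
  proof -
    have sub: "{1..i} \<subseteq> I" using that by (auto simp: I_def)
    have "\<omega> i = L2_set (\<lambda>(l, m). v l \<bullet> v m - (if l = m then 1 else 0)) ({1..i} \<times> {1..i})"
      unfolding \<omega>_def using sub v by (intro orth_loss_eq) auto
    also have "\<dots> = sqrt 2 * L2_set (\<lambda>(l, m). if l < m then v l \<bullet> v m - (if l = m then 1 else 0) else 0)
        ({1..i} \<times> {1..i})"
    proof (rule L2_set_upper_triangular)
      fix l m assume "l \<in> {1..i}" "m \<in> {1..i}"
      then have "v l \<bullet> v m = v m \<bullet> v l"
        using sub v by (intro comm_scalar_prod[where n = n]) auto
      then show "\<bar>v l \<bullet> v m - (if l = m then 1 else 0)\<bar> = \<bar>v m \<bullet> v l - (if m = l then 1 else 0)\<bar>"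
        by auto
    qed (use sub unit in auto)
    also have "(\<lambda>(l, m). if l < m then v l \<bullet> v m - (if l = m then 1 else 0) else 0) = (\<lambda>(l, m). U l m)"
      by (auto simp: U_def fun_eq_iff)
    finally show ?thesis .
  qed

  have entry: "\<gamma> * \<bar>U l m\<bar> \<le> \<bar>Y l m\<bar> + S * (\<Sum>k = 1..j. \<bar>U l k\<bar> * \<bar>U k m\<bar>)"
    if "l \<in> I" "m \<in> I" for l m
  proof (cases "l < m")
    case False
    then show ?thesis
      using S0 by (auto simp: U_def intro!: add_nonneg_nonneg mult_nonneg_nonneg sum_nonneg)
  next
    case True
    let ?t = "\<lambda>k. \<sigma> k * ((v l \<bullet> v k) * (v k \<bullet> v m))"
    \<comment> \<open>From \<open>l < m \<le> j + 1\<close> follows \<open>l \<le> j\<close>, so the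
      shifted value \<open>lam l + \<sigma> l\<close> takes part in the spectral gap.\<close>
    have lm: "1 \<le> l" "l \<le> j" "1 \<le> m" "m \<le> j + 1"
      using True that by (auto simp: I_def)
    have "\<gamma> * \<bar>U l m\<bar> \<le> \<bar>lam m - (lam l + \<sigma> l)\<bar> * \<bar>v l \<bullet> v m\<bar>"
      using True spectral_gap_le[OF lm] by (auto simp: U_def \<gamma>_def intro!: mult_right_mono)
    also have "\<dots> = \<bar>X l m + (\<Sum>k\<in>{l<..<m}. ?t k)\<bar>"
      unfolding abs_mult[symmetric] X_def using gram_recurrence[OF assms(2) lm(1) True lm(4)] by simp
    also have "\<dots> \<le> \<bar>X l m\<bar> + \<bar>\<Sum>k\<in>{l<..<m}. ?t k\<bar>"
      by (rule abs_triangle_ineq)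
    also have "\<bar>\<Sum>k\<in>{l<..<m}. ?t k\<bar> \<le> (\<Sum>k\<in>{l<..<m}. \<bar>?t k\<bar>)"
      by (rule sum_abs)
    also have "\<dots> \<le> (\<Sum>k\<in>{l<..<m}. S * (\<bar>U l k\<bar> * \<bar>U k m\<bar>))"
      using S lm by (intro sum_mono) (auto simp: abs_mult U_def intro!: mult_right_mono)
    \<comment> \<open>Every \<open>k < m\<close> is at most \<open>j\<close>. The added terms vanish
      because \<open>U\<close> is strictly upper triangular, and the range no longer depends on
      \<open>l\<close> and \<open>m\<close>, so the sum is an entry of a matrix product.\<close>
    also have "\<dots> \<le> (\<Sum>k = 1..j. S * (\<bar>U l k\<bar> * \<bar>U k m\<bar>))"
      using lm S0 by (intro sum_mono2) auto
    finally show ?thesis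
      using True by (simp add: Y_def sum_distrib_left)
  qed

  define u where "u = L2_set (\<lambda>(l, m). U l m) (I \<times> I)"
  define y where "y = L2_set (\<lambda>(l, m). Y l m) (I \<times> I)"
  have "\<gamma> * u = L2_set (\<lambda>(l, m). \<gamma> * \<bar>U l m\<bar>) (I \<times> I)"
    using \<gamma>0 by (simp add: u_def case_prod_unfold L2_set_right_distrib[symmetric] L2_set_abs)
  also have "\<dots> \<le> L2_set (\<lambda>(l, m). \<bar>Y l m\<bar> + S * (\<Sum>k = 1..j. \<bar>U l k\<bar> * \<bar>U k m\<bar>)) (I \<times> I)"
    using \<gamma>0 entry by (intro L2_set_mono) auto
  also have "\<dots> \<le> L2_set (\<lambda>(l, m). \<bar>Y l m\<bar>) (I \<times> I)
      + L2_set (\<lambda>(l, m). S * (\<Sum>k = 1..j. \<bar>U l k\<bar> * \<bar>U k m\<bar>)) (I \<times> I)"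
    using L2_set_triangle_ineq[of "\<lambda>(l, m). \<bar>Y l m\<bar>"] by (simp add: case_prod_unfold)
  also have "\<dots> = y + S * L2_set (\<lambda>(l, m). \<Sum>k = 1..j. \<bar>U l k\<bar> * \<bar>U k m\<bar>) (I \<times> I)"
    using S0 by (simp add: y_def case_prod_unfold L2_set_right_distrib[symmetric] L2_set_abs)
  also have "\<dots> \<le> y + S * (\<omega> j / sqrt 2 * u)"
  proof -
    have "L2_set (\<lambda>(l, m). \<Sum>k = 1..j. \<bar>U l k\<bar> * \<bar>U k m\<bar>) (I \<times> I)
        \<le> L2_set (\<lambda>(l, k). \<bar>U l k\<bar>) (I \<times> {1..j}) * L2_set (\<lambda>(k, m). \<bar>U k m\<bar>) ({1..j} \<times> I)"
      by (rule L2_set_matrix_mult_le)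
    \<comment> \<open>Row \<open>l = j + 1\<close> of \<open>U\<close> is zero in the columns
      \<open>k \<le> j\<close>. This is why \<open>\<omega> j\<close>, and not
      \<open>\<omega> (j + 1)\<close>, controls the absorbed term.\<close>
    also have "L2_set (\<lambda>(l, k). \<bar>U l k\<bar>) (I \<times> {1..j}) = L2_set (\<lambda>(l, k). U l k) ({1..j} \<times> {1..j})"
      unfolding L2_set_def
      by (intro arg_cong[where f = sqrt] sum.mono_neutral_cong_right) (auto simp: I_def U_def split: if_splits)
    also have "L2_set (\<lambda>(l, k). U l k) ({1..j} \<times> {1..j}) = \<omega> j / sqrt 2"
      by (simp add: loss)
    also have "L2_set (\<lambda>(k, m). \<bar>U k m\<bar>) ({1..j} \<times> I) \<le> u"
      unfolding u_def case_prod_unfold L2_set_abs by (intro L2_set_mono_set) (auto simp: I_def)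
    finally have "L2_set (\<lambda>(l, m). \<Sum>k = 1..j. \<bar>U l k\<bar> * \<bar>U k m\<bar>) (I \<times> I) \<le> \<omega> j / sqrt 2 * u"
      using \<omega>0 by (simp add: mult_left_mono divide_right_mono)
    then show ?thesis
      using S0 by (intro add_left_mono mult_left_mono)
  qed
  finally have "\<gamma> * u - S * (\<omega> j / sqrt 2 * u) \<le> y" by simp
  \<comment> \<open>Moving the quadratic term to the left turns \<open>\<gamma>\<close> into
    \<open>\<gamma> * d\<close>, since \<open>S / \<gamma>\<close> is the shift-gap ratio.\<close>
  moreover have "\<gamma> * u - S * (\<omega> j / sqrt 2 * u) = \<gamma> * d * u"
  proof -
    have "shift_gap_ratio lam \<sigma> j = S / \<gamma>"
      by (simp add: shift_gap_ratio_def S_def \<gamma>_def)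
    then show ?thesis
      using \<gamma>0 by (simp add: d_def field_simps)
  qed
  ultimately have "\<gamma> * d * u \<le> y" by simp
  then have "u \<le> y / (\<gamma> * d)"
    using \<gamma>0 d0 by (simp add: field_simps)
  moreover have \<omega>u: "\<omega> (j + 1) = sqrt 2 * u"
    by (simp add: loss u_def I_def)
  ultimately have "\<omega> (j + 1) \<le> sqrt 2 * (y / (\<gamma> * d))"
    by (simp only: mult_left_mono real_sqrt_ge_zero zero_le_numeral)
  also have "\<dots> = (sqrt 2 * y) / (\<gamma> * d)" by simp
  \<comment> \<open>\<open>X\<close> is antisymmetric, so the factor \<open>sqrt 2\<close> that came
    with \<open>\<omega>\<close> restores the full matrix from its upper half
    \<open>Y\<close>.\<close>
  also have "sqrt 2 * y = L2_set (\<lambda>(l, m). X l m) (I \<times> I)"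
    unfolding y_def Y_def by (rule L2_set_upper_triangular[symmetric]) (auto simp: X_def)
  also have "\<dots> \<le> 2 * (sqrt (1 + \<omega> (j + 1)) * e)"
  proof -
    \<comment> \<open>\<open>w\<close> is the Frobenius norm of \<open>E^T V\<close>, and
      \<open>X\<close> is this matrix minus its transpose; this yields the factor 2.\<close>
    define w where "w = L2_set (\<lambda>(l, m). \<eta> l \<bullet> v m) (I \<times> I)"
    have "L2_set (\<lambda>(l, m). X l m) (I \<times> I)
        \<le> w + L2_set (\<lambda>(l, m). - (\<eta> m \<bullet> v l)) (I \<times> I)"
      using L2_set_triangle_ineq[of "\<lambda>(l, m). \<eta> l \<bullet> v m" "\<lambda>(l, m). - (\<eta> m \<bullet> v l)" "I \<times> I"]
      by (simp add: w_def X_def case_prod_unfold)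
    also have "L2_set (\<lambda>(l, m). - (\<eta> m \<bullet> v l)) (I \<times> I) = w"
      using L2_set_transpose[of "\<lambda>l m. \<eta> l \<bullet> v m" I I]
      by (simp add: w_def L2_set_def case_prod_unfold)
    also have "w \<le> sqrt (1 + \<omega> (j + 1)) * e"
    proof (rule power2_le_imp_le)
      have "w\<^sup>2 = (\<Sum>l\<in>I. \<Sum>m\<in>I. (\<eta> l \<bullet> v m)\<^sup>2)"
        by (simp add: w_def L2_set_squared sum.cartesian_product case_prod_unfold)
      \<comment> \<open>Row \<open>l\<close> of \<open>E^T V\<close> is \<open>V^T \<eta>_l\<close>
        transposed, so the spectral norm bound on \<open>V\<close> applies row by row.\<close>
      also have "\<dots> \<le> (\<Sum>l\<in>I. (1 + \<omega> (j + 1)) * (\<eta> l \<bullet> \<eta> l))"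
        unfolding I_def \<omega>_def using v \<eta>
        by (intro sum_mono sum_scalar_prod_squares_le) (auto simp: I_def)
      also have "\<dots> = (1 + \<omega> (j + 1)) * e\<^sup>2"
        unfolding e_def sum_distrib_left[symmetric]
        using \<eta> by (subst frobenius_col_mat_squared) (auto simp: I_def)
      finally show "w\<^sup>2 \<le> (sqrt (1 + \<omega> (j + 1)) * e)\<^sup>2"
        using \<omega>0[of "j + 1"] by (simp add: power_mult_distrib)
    qed (use e0 \<omega>0[of "j + 1"] in simp)
    finally show ?thesis by (simp add: mult_ac)
  qed
  finally have "\<omega> (j + 1) \<le> 2 * (sqrt (1 + \<omega> (j + 1)) * e) / (\<gamma> * d)"
    using \<gamma>0 d0 by (simp add: divide_right_mono)
  then have "\<omega> (j + 1) \<le> 2 * (inverse d / \<gamma> * e) * sqrt (1 + \<omega> (j + 1))"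
    by (simp add: field_simps)
  \<comment> \<open>The loss still occurs under the root on the right; the scalar inequality with
    \<open>a = inverse d / \<gamma> * e\<close> removes it.\<close>
  then have "\<omega> (j + 1) \<le> 2 * (inverse d / \<gamma> * e) * (1 + 2 * (inverse d / \<gamma> * e))"
    using \<omega>0 e0 d0 \<gamma>0 by (intro le_of_le_mult_sqrt) auto
  then have "\<omega> (j + 1) \<le> 2 * (inverse d / \<gamma>) * (1 + 2 * (inverse d / \<gamma>) * e) * e"
    by (simp add: mult_ac)
  then show ?thesis
    by (simp add: Let_def \<omega>_def d_def e_def \<gamma>_def)
qed

end
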